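(* Let $l\ge 3$ and $k\ge1$ be integers. For every $l$-uniform hypergraph $H$ with $\chi_{\mathrm{cf}}(H)=k$ having $n\ge 2kl$ vertices, $\chi_{\mathrm{um}}(H)\le n-\lceil n/k\rceil-l+4$. Moreover, this is best possible: for every $n\ge 2kl$ there exists an $l$-uniform hypergraph $H$ on $n$ vertices with $\chi_{\mathrm{cf}}(H)=k$ for which $\chi_{\mathrm{um}}(H)= n-\lceil n/k\rceil-l+4$.
   Context: A hypergraph $H=(V,E)$ has a finite vertex set $V$ and a set $E$ of nonempty subsets of $V$; it is $l$-uniform if every hyperedge has exactly $l$ elements. A unique-maximum coloring of $H$ with $k$ colors is a function $C\colon V\to\{1,\dots,k\}$ such that for each $e\in E$ the maximum color among the colors of the vertices of $e$ occurs exactly once on $e$; $\chi_{\mathrm{um}}(H)$ is the minimum such $k$. A conflict-free coloring of $H$ with $k$ colors is a function $C\colon V\to\{1,\dots,k\}$ such that for each $e\in E$ some color occurs exactly once on the vertices of $e$; $\chi_{\mathrm{cf}}(H)$ is the minimum such $k$.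
   Formalization: The case k = 1 with l ≥ 4 is excluded: there the hypergraph has no edges, so χ_um = 1, while the claimed bound n − ⌈n/k⌉ − l + 4 = 4 − l is at most 0, and both parts of the statement are false. *)

theory Defs
  imports Complex_Main "HOL-Library.FuncSet"
begin

definition hypergraph :: "'a set \<Rightarrow> 'a set set \<Rightarrow> bool" where
  "hypergraph V E \<longleftrightarrow> finite V \<and> (\<forall>e\<in>E. e \<subseteq> V \<and> e \<noteq> {})"

definition uniform_hypergraph :: "nat \<Rightarrow> 'a set \<Rightarrow> 'a set set \<Rightarrow> bool" where
  "uniform_hypergraph l V E \<longleftrightarrow> hypergraph V E \<and> (\<forall>e\<in>E. card e = l)"

definition um_coloring :: "'a set \<Rightarrow> 'a set set \<Rightarrow> nat \<Rightarrow> ('a \<Rightarrow> nat) \<Rightarrow> bool" where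
  "um_coloring V E k C \<longleftrightarrow>
     C \<in> V \<rightarrow> {1..k} \<and> (\<forall>e\<in>E. \<exists>!v. v \<in> e \<and> C v = Max (C ` e))"

definition cf_coloring :: "'a set \<Rightarrow> 'a set set \<Rightarrow> nat \<Rightarrow> ('a \<Rightarrow> nat) \<Rightarrow> bool" where
  "cf_coloring V E k C \<longleftrightarrow>
     C \<in> V \<rightarrow> {1..k} \<and> (\<forall>e\<in>E. \<exists>c. \<exists>!v. v \<in> e \<and> C v = c)"

text \<open>For a hypergraph the minima below exist: an injective coloring is unique-maximum,
  and a unique-maximum coloring is conflict-free.\<close>

definition chi_um :: "'a set \<Rightarrow> 'a set set \<Rightarrow> nat" where
  "chi_um V E = (LEAST k. \<exists>C. um_coloring V E k C)"

definition chi_cf :: "'a set \<Rightarrow> 'a set set \<Rightarrow> nat" where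
  "chi_cf V E = (LEAST k. \<exists>C. cf_coloring V E k C)"

lemma ex_um_coloring:
  assumes "hypergraph V E"
  shows "\<exists>k C. um_coloring V E k C"
proof -
  have fin: "finite V" and sub: "\<And>e. e \<in> E \<Longrightarrow> e \<subseteq> V \<and> e \<noteq> {}"
    using assms by (auto simp: hypergraph_def)
  obtain f where f: "bij_betw f V {1..card V}"
    using ex_bij_betw_finite_nat[OF fin] fin by (metis finite_same_card_bij card_atLeastAtMost finite_atLeastAtMost diff_Suc_1)
  have "\<exists>!v. v \<in> e \<and> f v = Max (f ` e)" if "e \<in> E" for e
  proof -
    have e: "e \<subseteq> V" "e \<noteq> {}" "finite e" using sub[OF that] fin finite_subset by auto
    then have "Max (f ` e) \<in> f ` e" by simp
    then obtain v where "v \<in> e" "f v = Max (f ` e)" by auto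
    moreover have "inj_on f e"
      using f e(1) by (meson bij_betw_imp_inj_on inj_on_subset)
    ultimately show ?thesis by (metis inj_onD)
  qed
  then have "um_coloring V E (card V) f"
    using f by (auto simp: um_coloring_def bij_betw_def)
  then show ?thesis by blast
qed

text \<open>The bound \<open>n - \<lceil>n/k\<rceil> - l + 4\<close> equals \<open>4 - l\<close> for \<open>k = 1\<close>, so for \<open>l \<ge> 4\<close> it is
  violated by every nonempty vertex set, while edgeless hypergraphs do satisfy
  \<open>chi_cf = 1\<close>. Hence \<open>k = 1\<close> has to be accompanied by \<open>l = 3\<close>.\<close>

lemma chi_um_pos:
  assumes "hypergraph V E" "V \<noteq> {}"
  shows "chi_um V E \<ge> 1"
proof -
  have "\<exists>C. um_coloring V E (chi_um V E) C"
    unfolding chi_um_def using ex_um_coloring[OF assms(1)] by (rule LeastI_ex)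
  then show ?thesis using assms(2) by (fastforce simp: um_coloring_def Pi_iff)
qed

lemma chi_cf_no_edges:
  assumes "V \<noteq> {}"
  shows "chi_cf V {} = 1"
  unfolding chi_cf_def
proof (rule Least_equality)
  show "\<exists>C. cf_coloring V {} 1 C"
    by (rule exI[of _ "\<lambda>_. 1"]) (simp add: cf_coloring_def)
  show "1 \<le> k" if "\<exists>C. cf_coloring V {} k C" for k
    using that assms by (fastforce simp: cf_coloring_def Pi_iff)
qed

lemma bound_fails_for_one_color:
  assumes "l \<ge> 4" "uniform_hypergraph l V E" "V \<noteq> {}"
  shows "int (chi_um V E) > int (card V) - \<lceil>real (card V) / real 1\<rceil> - int l + 4"
  using chi_um_pos[of V E] assms by (simp add: uniform_hypergraph_def)

end

theory Submission
  imports Defs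
begin

text \<open>Upper bound: let \<open>A\<close> be a largest color class of a conflict-free coloring with \<open>k\<close> colors.
  Giving \<open>A\<close> the color 1, a set \<open>B\<close> of \<open>l - 2\<close> vertices inside a second color class the color 2, and
  all other vertices distinct larger colors is a unique-maximum coloring: an edge inside
  \<open>A \<union> B\<close> with at least two vertices in \<open>B\<close> also has at least two vertices in \<open>A\<close>, so it would
  not be conflict-free. If there is no such \<open>B\<close>, then \<open>A\<close> is so large that it suffices to
  color all vertices outside \<open>A\<close> distinctly.

  Sharpness: split the vertices evenly into \<open>k\<close> parts and take all \<open>l\<close>-sets meeting some part
  exactly once. In a unique-maximum coloring consider the largest color that occurs twice and
  the set \<open>L\<close> of vertices with at most that color. Vertices outside \<open>L\<close> have distinct colors,
  and an \<open>l\<close>-set inside \<open>L\<close> containing two vertices of that color is not an edge, which forces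
  \<open>L\<close> to be small. In a conflict-free coloring every color class with more than \<open>2l - 4\<close> vertices
  lies in one part, and counting then shows that there are at least \<open>k\<close> colors.\<close>

section \<open>The upper bound\<close>

lemma ex1_MaxI:
  fixes C :: "'a \<Rightarrow> nat"
  assumes "finite e" "v \<in> e" "\<And>w. w \<in> e \<Longrightarrow> w \<noteq> v \<Longrightarrow> C w < C v"
  shows "\<exists>!v. v \<in> e \<and> C v = Max (C ` e)"
proof -
  have "Max (C ` e) = C v"
    using assms by (intro Max_eqI) (auto, metis less_imp_le order_refl)
  then show ?thesis
    using assms(2,3) by (metis less_irrefl)
qed

lemma not_ex1_Max:
  fixes C :: "'a \<Rightarrow> nat"
  assumes "finite e" "u \<in> e" "v \<in> e" "u \<noteq> v" "C u = C v" "\<And>w. w \<in> e \<Longrightarrow> C w \<le> C u"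
  shows "\<not> (\<exists>!v. v \<in> e \<and> C v = Max (C ` e))"
proof -
  have "Max (C ` e) = C u"
    using assms by (intro Max_eqI) auto
  then show ?thesis
    using assms by metis
qed

text \<open>Vertices outside \<open>L\<close> get distinct colors above \<open>r\<close>, so an edge
  leaving \<open>L\<close> attains its maximum at exactly one outside vertex. Only edges inside
  \<open>L\<close> depend on \<open>g\<close>.\<close>

lemma um_coloring_extend:
  assumes "hypergraph V E" and L: "L \<subseteq> V" and g: "g \<in> L \<rightarrow> {1..r}"
    and um: "\<And>e. e \<in> E \<Longrightarrow> e \<subseteq> L \<Longrightarrow> \<exists>!v. v \<in> e \<and> g v = Max (g ` e)"
  shows "\<exists>C. um_coloring V E (r + card (V - L)) C"
proof -
  have fin: "finite V" and sub: "\<And>e. e \<in> E \<Longrightarrow> e \<subseteq> V \<and> e \<noteq> {}"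
    using assms by (auto simp: hypergraph_def)
  obtain h where h: "bij_betw h (V - L) {0..<card (V - L)}"
    using ex_bij_betw_finite_nat[of "V - L"] fin by blast
  \<comment> \<open>As \<open>h\<close> counts from 0, the outside vertices use exactly the colors
    from \<open>r + 1\<close> to \<open>r + card (V - L)\<close>.\<close>
  define C where "C v = (if v \<in> L then g v else r + 1 + h v)" for v
  have "\<exists>!v. v \<in> e \<and> C v = Max (C ` e)" if e: "e \<in> E" for e
  proof (cases "e \<subseteq> L")
    case True
    then have eq: "\<And>v. v \<in> e \<Longrightarrow> C v = g v" by (auto simp: C_def)
    then have "C ` e = g ` e" by simp
    with um[OF e True] eq show ?thesis by metis
  next
    case False
    then obtain x where x: "x \<in> e" "x \<notin> L" by blast
    have fe: "finite e" "e \<noteq> {}" using sub[OF e] fin finite_subset by auto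
    then have "Max (C ` e) \<in> C ` e" by simp
    then obtain v where v: "v \<in> e" "C v = Max (C ` e)" by auto
    have big: "C w \<le> C v" if "w \<in> e" for w
      using v fe that by simp
    have low: "C w \<le> r" if "w \<in> L" for w
      using that g by (auto simp: C_def Pi_iff)
    have "C x > r" using x by (simp add: C_def)
    then have nv: "C v > r" using big[OF x(1)] by simp
    have "C w < C v" if "w \<in> e" "w \<noteq> v" for w
    proof (rule ccontr)
      assume "\<not> ?thesis"
      with big[OF that(1)] have eq: "C w = C v" by simp
      then have "w \<notin> L" "v \<notin> L" using low nv by (metis leD)+
      then have "h w = h v" "w \<in> V - L" "v \<in> V - L"
        using eq that v sub[OF e] by (auto simp: C_def)
      then show False
        using h that(2) by (auto simp: bij_betw_def inj_on_def)
    qed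
    then show ?thesis using ex1_MaxI fe(1) v(1) by metis
  qed
  moreover have "C v \<in> {1..r + card (V - L)}" if "v \<in> V" for v
  proof (cases "v \<in> L")
    case True
    then show ?thesis using g by (fastforce simp: C_def Pi_iff)
  next
    case False
    then have "h v < card (V - L)" using h that by (auto simp: bij_betw_def)
    then show ?thesis using False by (simp add: C_def)
  qed
  ultimately show ?thesis unfolding um_coloring_def by blast
qed

lemma chi_um_le: "um_coloring V E m C \<Longrightarrow> chi_um V E \<le> m"
  unfolding chi_um_def by (rule Least_le) blast

lemma cf_coloring_chi_cf:
  assumes "hypergraph V E"
  shows "\<exists>C. cf_coloring V E (chi_cf V E) C"
proof -
  obtain k C where um: "um_coloring V E k C" using ex_um_coloring[OF assms] by blast
  then have "\<exists>c. \<exists>!v. v \<in> e \<and> C v = c" if "e \<in> E" for e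
    using that unfolding um_coloring_def by (intro exI[of _ "Max (C ` e)"]) simp
  with um have "cf_coloring V E k C" by (simp add: um_coloring_def cf_coloring_def)
  then have "\<exists>k C. cf_coloring V E k C" by blast
  then show ?thesis unfolding chi_cf_def by (rule LeastI_ex)
qed

section \<open>Unique-maximum colorings from the classes of a conflict-free coloring\<close>

lemma cf_coloring_edgeE:
  assumes "cf_coloring V E k C" "e \<in> E"
  obtains v where "v \<in> e" "\<And>w. w \<in> e \<Longrightarrow> C w = C v \<Longrightarrow> w = v"
proof -
  have "\<exists>c. \<exists>!v. v \<in> e \<and> C v = c"
    using assms unfolding cf_coloring_def by (elim conjE) (rule bspec)
  then obtain c where "\<exists>!v. v \<in> e \<and> C v = c" ..
  then show ?thesis using that by (elim ex1E) metis
qed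

text \<open>A class contains no edge: on a monochromatic edge with at least two vertices no color
  occurs exactly once.\<close>

lemma chi_um_le_one_class:
  assumes H: "uniform_hypergraph l V E" and cf: "cf_coloring V E k f" and "2 \<le> l"
  shows "chi_um V E \<le> 1 + card (V - {v \<in> V. f v = i})"
proof -
  let ?A = "{v \<in> V. f v = i}"
  have False if e: "e \<in> E" "e \<subseteq> ?A" for e
  proof -
    obtain v where "v \<in> e" and v: "\<And>w. w \<in> e \<Longrightarrow> f w = f v \<Longrightarrow> w = v"
      using cf_coloring_edgeE[OF cf e(1)] by blast
    have "f w = f v" if "w \<in> e" for w
      using e that \<open>v \<in> e\<close> by blast
    with v have "e \<subseteq> {v}" by blast
    then have "card e \<le> 1" using card_mono[of "{v}" e] by simp
    then show False using H e(1) \<open>2 \<le> l\<close> by (auto simp: uniform_hypergraph_def)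
  qed
  then have "\<exists>C. um_coloring V E (1 + card (V - ?A)) C"
    using H by (intro um_coloring_extend[where g = "\<lambda>_. 1"]) (auto simp: uniform_hypergraph_def)
  then show ?thesis using chi_um_le by blast
qed

text \<open>The size \<open>l - 2\<close> of \<open>B\<close> forces an edge inside the union to
  have two vertices in class \<open>i\<close>. So its uniquely colored vertex lies in
  \<open>B\<close>, and since \<open>B\<close> is monochromatic under \<open>f\<close>, the edge
  meets \<open>B\<close> only there.\<close>

lemma chi_um_le_two_classes:
  assumes H: "uniform_hypergraph l V E" and cf: "cf_coloring V E k f" and "2 \<le> l"
    and "i \<noteq> j" and B: "B \<subseteq> {v \<in> V. f v = j}" "card B = l - 2"
  shows "chi_um V E \<le> 2 + card (V - ({v \<in> V. f v = i} \<union> B))"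
proof -
  let ?A = "{v \<in> V. f v = i}"
  define g where "g v = (if v \<in> B then 2 else 1 :: nat)" for v
  have hyp: "hypergraph V E" using H by (simp add: uniform_hypergraph_def)
  have "\<exists>!v. v \<in> e \<and> g v = Max (g ` e)" if e: "e \<in> E" "e \<subseteq> ?A \<union> B" for e
  proof -
    have fe: "finite e"
      using hyp e(1) by (auto simp: hypergraph_def intro: finite_subset)
    have fB: "finite B"
      using hyp B(1) by (auto simp: hypergraph_def intro: finite_subset)
    have "card e = l" using H e(1) by (simp add: uniform_hypergraph_def)
    then have "card (e - B) \<ge> 2"
      using B(2) \<open>2 \<le> l\<close> diff_card_le_card_Diff[OF fB, of e] by simp
    then have eA: "\<not> card (e - B) \<le> Suc 0" by simp
    obtain v where v: "v \<in> e" "\<And>w. w \<in> e \<Longrightarrow> f w = f v \<Longrightarrow> w = v"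
      using cf_coloring_edgeE[OF cf e(1)] by blast
    have "v \<in> B"
    proof (rule ccontr)
      assume "v \<notin> B"
      then have "f v = i" using v e by auto
      then have "e - B \<subseteq> {v}" using e v by blast
      then show False using eA card_mono[of "{v}" "e - B"] by simp
    qed
    then have "f v = j" using B v by auto
    then have "w \<notin> B" if "w \<in> e" "w \<noteq> v" for w using that B(1) v(2) by auto
    then have "g w < g v" if "w \<in> e" "w \<noteq> v" for w
      using that \<open>v \<in> B\<close> by (simp add: g_def)
    then show ?thesis by (rule ex1_MaxI[OF fe v(1)])
  qed
  moreover have "g \<in> ?A \<union> B \<rightarrow> {1..2}" by (auto simp: g_def)
  ultimately have "\<exists>C. um_coloring V E (2 + card (V - (?A \<union> B))) C"
    using hyp B(1) by (intro um_coloring_extend[where g = g]) auto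
  then show ?thesis using chi_um_le by blast
qed

text \<open>Replaces the real ceiling by inequalities between natural numbers, so that the counting
  arguments stay in \<open>nat\<close>.\<close>

lemma nat_ceiling_divideE:
  fixes n k :: nat
  assumes "1 \<le> k"
  obtains c :: nat where "\<lceil>real n / real k\<rceil> = int c" "n \<le> k * c" "k * c < n + k"
    "\<And>a. n \<le> k * a \<Longrightarrow> c \<le> a"
proof -
  define c where "c = nat \<lceil>real n / real k\<rceil>"
  have k: "real k > 0" using assms by simp
  have "0 \<le> real n / real k" by simp
  then have c: "\<lceil>real n / real k\<rceil> = int c" unfolding c_def by linarith
  have "real n / real k \<le> real c" "real c < real n / real k + 1"
    using c by linarith+
  then have "real n \<le> real k * real c" "real k * real c < real n + real k"
    using k by (simp_all add: field_simps)
  then have "n \<le> k * c" and less: "k * c < n + k"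
    by (simp_all flip: of_nat_mult of_nat_add add: of_nat_le_iff of_nat_less_iff)
  moreover have "c \<le> a" if "n \<le> k * a" for a
  proof (rule ccontr)
    assume "\<not> ?thesis"
    then have "k * Suc a \<le> k * c" by (intro mult_le_mono) auto
    then show False using that less by simp
  qed
  ultimately show ?thesis using c that by blast
qed

lemma chi_um_upper_bound:
  assumes H: "uniform_hypergraph l V E" and chi: "chi_cf V E = k" and n: "2 * k * l \<le> card V"
    and l: "3 \<le> l" and k: "1 \<le> k" and k1: "k = 1 \<Longrightarrow> l = 3"
  shows "int (chi_um V E) \<le> int (card V) - \<lceil>real (card V) / real k\<rceil> - int l + 4"
proof -
  have hyp: "hypergraph V E" and fV: "finite V"
    using H by (auto simp: uniform_hypergraph_def hypergraph_def)
  obtain f where f: "cf_coloring V E k f"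
    using cf_coloring_chi_cf[OF hyp] chi by blast
  then have fP: "f \<in> V \<rightarrow> {1..k}" by (simp add: cf_coloring_def)
  obtain c where c: "\<lceil>real (card V) / real k\<rceil> = int c" "card V \<le> k * c" "k * c < card V + k"
    and c_le: "\<And>a. card V \<le> k * a \<Longrightarrow> c \<le> a"
    using nat_ceiling_divideE[OF k] by metis
  \<comment> \<open>The largest class has at least the average size, and \<open>c_le\<close> then
    rounds this up to \<open>c\<close>.\<close>
  obtain i where i: "i \<in> {1..k}" "card (f -` {i} \<inter> V) * card {1..k} \<ge> card V"
    using pigeonhole_card[OF fP] fV k by auto
  define A where "A = {v \<in> V. f v = i}"
  have "f -` {i} \<inter> V = A" by (auto simp: A_def)
  with i have "card V \<le> k * card A" by (simp add: mult.commute)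
  then have cA: "c \<le> card A" by (rule c_le)
  have AV: "card (V - A) = card V - card A" "card A \<le> card V"
    using fV by (auto simp: A_def card_Diff_subset card_mono)
  have one: "chi_um V E \<le> 1 + card (V - A)"
    using chi_um_le_one_class[OF H f] l by (simp add: A_def)
  \<comment> \<open>For \<open>l = 3\<close> the target is \<open>1 + (n - c)\<close> with
    \<open>n = card V\<close>, so merging \<open>A\<close> alone suffices. Otherwise either another
    class can supply \<open>B\<close>, or all other classes are small.\<close>
  consider "l = 3"
    | j where "j \<noteq> i" "l - 2 \<le> card {v \<in> V. f v = j}"
    | "l > 3" "\<And>j. j \<noteq> i \<Longrightarrow> card {v \<in> V. f v = j} \<le> l - 3"
  proof (cases "l = 3 \<or> (\<exists>j. j \<noteq> i \<and> l - 2 \<le> card {v \<in> V. f v = j})")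
    case False
    then have "l > 3" and "\<And>j. j \<noteq> i \<Longrightarrow> card {v \<in> V. f v = j} < l - 2"
      using l by (auto simp: not_le)
    then show ?thesis using that(3) by force
  qed (use that in blast)
  then show ?thesis
  proof cases
    case 1
    then show ?thesis using one AV cA c(1) by simp
  next
    case (2 j)
    then obtain B where B: "B \<subseteq> {v \<in> V. f v = j}" "card B = l - 2"
      by (metis obtain_subset_with_card_n)
    have "finite B" "finite A" "A \<inter> B = {}" "A \<union> B \<subseteq> V"
      using B 2 fV by (auto simp: A_def intro: finite_subset)
    then have "card (V - (A \<union> B)) = card V - (card A + (l - 2))" "card A + (l - 2) \<le> card V"
      using B fV by (metis card_Diff_subset card_Un_disjoint finite_Un, metis B(2) card_Un_disjoint card_mono fV)
    moreover have "chi_um V E \<le> 2 + card (V - (A \<union> B))"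
      using chi_um_le_two_classes[OF H f _ _ B, of i] l 2 by (simp add: A_def)
    ultimately show ?thesis using cA c(1) l by simp
  next
    case 3
    have k2: "2 \<le> k" using k1 k 3 by (cases "k = 1") auto
    have "V - A \<subseteq> (\<Union>j\<in>{1..k} - {i}. {v \<in> V. f v = j})"
      using fP by (auto simp: A_def)
    then have "card (V - A) \<le> card (\<Union>j\<in>{1..k} - {i}. {v \<in> V. f v = j})"
      using fV by (intro card_mono) auto
    also have "\<dots> \<le> (\<Sum>j\<in>{1..k} - {i}. card {v \<in> V. f v = j})"
      by (rule card_UN_le) simp
    also have "\<dots> \<le> (\<Sum>j\<in>{1..k} - {i}. l - 3)"
      using 3 by (intro sum_mono) auto
    also have "\<dots> = (k - 1) * (l - 3)" using i by simp
    \<comment> \<open>By \<open>one\<close>, it remains to bound this left-hand side by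
      \<open>card V - c\<close>. The bound \<open>k * (l - 3)\<close> is below half of
      \<open>card V\<close>, while \<open>c\<close> is at most about half of it.\<close>
    finally have "card (V - A) + (l - 3) \<le> k * (l - 3)"
      using k by (cases k) auto
    moreover have "2 * k * (l - 3) + 6 * k \<le> card V"
    proof -
      obtain d where "l = d + 3" using l by (metis add.commute le_Suc_ex)
      then show ?thesis using n by (simp add: algebra_simps)
    qed
    \<comment> \<open>With \<open>c = Suc d\<close>, the ceiling gives
      \<open>k * d < card V\<close>, and \<open>k \<ge> 2\<close> turns this into the claim.\<close>
    moreover have "2 * c \<le> card V + 1"
    proof (cases c)
      case (Suc d)
      then have "k * d < card V" using c(3) by simp
      moreover have "2 * d \<le> k * d" using k2 by (rule mult_le_mono1)
      ultimately show ?thesis using Suc by linarith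
    qed simp
    ultimately show ?thesis using one c(1) l k2 by simp
  qed
qed

section \<open>Sharpness\<close>

text \<open>\<open>p\<close> assigns each vertex its part. These are all the \<open>l\<close>-sets
  on which some value of \<open>p\<close> occurs exactly once, so this is the largest
  \<open>l\<close>-uniform hypergraph for which \<open>p\<close> is conflict-free.\<close>

definition isolating_sets :: "nat \<Rightarrow> 'a set \<Rightarrow> ('a \<Rightarrow> 'b) \<Rightarrow> 'a set set" where
  "isolating_sets l V p = {e. e \<subseteq> V \<and> card e = l \<and> (\<exists>w\<in>e. \<forall>v\<in>e. v \<noteq> w \<longrightarrow> p v \<noteq> p w)}"

lemma uniform_isolating_sets:
  assumes "finite V" "0 < l"
  shows "uniform_hypergraph l V (isolating_sets l V p)"
  using assms by (auto simp: uniform_hypergraph_def hypergraph_def isolating_sets_def)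

text \<open>Adding \<open>w\<close> to \<open>l - 1\<close> vertices of other parts always gives an
  edge. The set \<open>U\<close> prescribes vertices that make this edge violate a given
  coloring.\<close>

lemma ex_isolating_set:
  assumes "finite V" "L \<subseteq> V" "w \<in> L" "U \<subseteq> {x \<in> L. p x \<noteq> p w}"
    and "0 < l" "card U \<le> l - 1" "l - 1 \<le> card {x \<in> L. p x \<noteq> p w}"
  obtains e where "e \<in> isolating_sets l V p" "e \<subseteq> L" "w \<in> e" "U \<subseteq> e"
proof -
  have fL: "finite L" using assms finite_subset by blast
  then obtain T where T: "U \<subseteq> T" "T \<subseteq> {x \<in> L. p x \<noteq> p w}" "card T = l - 1"
    using exists_subset_between[OF assms(6,7,4)] by auto
  then have "finite T" "w \<notin> T" using fL by (auto intro: finite_subset)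
  then have "card (insert w T) = l" using T assms by simp
  then have "insert w T \<in> isolating_sets l V p"
    unfolding isolating_sets_def using T assms by auto
  then show ?thesis using that T assms by blast
qed

section \<open>Lower bounds for colorings of the isolating sets\<close>

lemma card_le_two_complements:
  assumes "finite L" "a \<noteq> b"
    and "card {x \<in> L. p x \<noteq> a} \<le> s" "card {x \<in> L. p x \<noteq> b} \<le> s"
  shows "card L \<le> 2 * s"
proof -
  have "L = {x \<in> L. p x \<noteq> a} \<union> {x \<in> L. p x \<noteq> b}" using assms by auto
  then have "card L \<le> card {x \<in> L. p x \<noteq> a} + card {x \<in> L. p x \<noteq> b}"
    by (metis card_Un_le)
  then show ?thesis using assms by simp
qed

text \<open>With \<open>l - 1\<close> vertices of \<open>L\<close> outside the part of
  \<open>w\<close>, some edge inside \<open>L\<close> would contain both \<open>u\<close> and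
  \<open>v\<close>, repeating its maximum color.\<close>

lemma um_coloring_isolating_part:
  assumes "finite V" "3 \<le> l" and C: "um_coloring V (isolating_sets l V p) m C"
    and uv: "u \<in> V" "v \<in> V" "u \<noteq> v" "C u = C v"
    and L: "L = {x \<in> V. C x \<le> C u}" and w: "w \<in> L" "p u \<noteq> p w \<or> p v \<noteq> p w"
  shows "card {x \<in> L. p x \<noteq> p w} \<le> l - 2"
proof (rule ccontr)
  assume "\<not> ?thesis"
  then have big: "l - 1 \<le> card {x \<in> L. p x \<noteq> p w}" by simp
  \<comment> \<open>At most one of \<open>u\<close>, \<open>v\<close> shares the part of
    \<open>w\<close>. Taking that one as the isolated vertex leaves the rest of the pair in other
    parts; \<open>l \<ge> 3\<close> leaves room for both.\<close>
  define w' where "w' = (if p u = p w then u else if p v = p w then v else w)"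
  have w': "p w' = p w" "w' \<in> L"
    using w uv L by (auto simp: w'_def)
  let ?U = "{u, v} - {w'}"
  have sub: "?U \<subseteq> {x \<in> L. p x \<noteq> p w'}"
    using w uv L by (auto simp: w'_def)
  have "card ?U \<le> card {u, v}" by (intro card_mono) auto
  also have "\<dots> = 2" using uv by simp
  finally have card: "card ?U \<le> l - 1" using assms(2) by simp
  obtain e where e: "e \<in> isolating_sets l V p" "e \<subseteq> L" "w' \<in> e" "?U \<subseteq> e"
    using ex_isolating_set[of V L w' ?U p l] sub card big w' L assms(1,2) by auto
  have "finite e" using e L assms(1) by (auto intro: finite_subset)
  moreover have "u \<in> e" "v \<in> e" using e by auto
  moreover have "\<And>x. x \<in> e \<Longrightarrow> C x \<le> C u" using e L by auto
  ultimately have "\<not> (\<exists>!v. v \<in> e \<and> C v = Max (C ` e))"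
    using not_ex1_Max uv by metis
  then show False using C e(1) by (simp add: um_coloring_def)
qed

lemma um_coloring_isolating_lower_bound:
  assumes fV: "finite V" and l: "3 \<le> l" and C: "um_coloring V (isolating_sets l V p) m C"
    and c: "\<And>i. card {x \<in> V. p x = i} \<le> c" and lc: "l \<le> c"
  shows "card V + 4 \<le> m + c + l"
proof -
  have CV: "C ` V \<subseteq> {1..m}" using C by (auto simp: um_coloring_def)
  \<comment> \<open>The vertices whose color is repeated; the largest color on \<open>R\<close> is
    the threshold defining \<open>L\<close>.\<close>
  define R where "R = {u \<in> V. \<exists>v\<in>V. v \<noteq> u \<and> C v = C u}"
  show ?thesis
  proof (cases "R = {}")
    case True
    then have "inj_on C V" by (auto simp: R_def inj_on_def)
    then have "card V \<le> m" using CV card_inj_on_le[of C V "{1..m}"] by simp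
    then show ?thesis using l lc by simp
  next
    case False
    have "finite R" using fV by (simp add: R_def)
    then have "Max (C ` R) \<in> C ` R" using False by simp
    then obtain u where u: "u \<in> R" "C u = Max (C ` R)" by auto
    then have max: "C x \<le> C u" if "x \<in> R" for x
      using \<open>finite R\<close> that by simp
    obtain v where uv: "u \<in> V" "v \<in> V" "u \<noteq> v" "C u = C v"
      using u(1) unfolding R_def by auto
    define L where "L = {x \<in> V. C x \<le> C u}"
    have L: "finite L" "L \<subseteq> V" "u \<in> L" "v \<in> L" using fV uv by (auto simp: L_def)
    have inj: "inj_on C (V - L)"
    proof (rule inj_onI, rule ccontr)
      fix x y assume "x \<in> V - L" "y \<in> V - L" "C x = C y" "x \<noteq> y"
      then have "x \<in> R" by (auto simp: R_def)
      with max \<open>x \<in> V - L\<close> show False by (auto simp: L_def)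
    qed
    \<comment> \<open>\<open>L\<close> is cut out by a color threshold, so no color occurs on both
      sides. Hence \<open>m\<close> is at least \<open>card (V - L)\<close> plus the number of
      colors on \<open>L\<close>, and only \<open>card L\<close> remains to be bounded.\<close>
    have "C ` (V - L) \<inter> C ` L = {}" by (auto simp: L_def)
    then have "card (C ` (V - L)) + card (C ` L) = card (C ` (V - L) \<union> C ` L)"
      using fV L by (simp add: card_Un_disjoint)
    also have "\<dots> \<le> card {1..m}" using CV L by (intro card_mono) auto
    finally have "card (V - L) + card (C ` L) \<le> m" using inj by (simp add: card_image)
    then have m: "card V + card (C ` L) \<le> m + card L"
      using L fV by (simp add: card_Diff_subset)
    have CL: "1 \<le> card (C ` L)" using L by (auto simp: Suc_le_eq card_gt_0_iff)
    have part: "card {x \<in> L. p x \<noteq> p w} \<le> l - 2"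
      if "w \<in> L" "x \<in> V" "y \<in> V" "x \<noteq> y" "C x = C u" "C y = C u" "p x \<noteq> p w \<or> p y \<noteq> p w" for w x y
      using um_coloring_isolating_part[OF fV l C, of x y L w] that by (auto simp: L_def)
    \<comment> \<open>If the threshold color meets two parts, \<open>part\<close> applies to both of
      them, so \<open>card L \<le> 2 * (l - 2)\<close>.\<close>
    have two: ?thesis if "x \<in> V" "y \<in> V" "C x = C u" "C y = C u" "p x \<noteq> p y" for x y
    proof -
      have "x \<noteq> y" using that by auto
      have "x \<in> L" "y \<in> L" using that by (auto simp: L_def)
      then have "card {z \<in> L. p z \<noteq> p x} \<le> l - 2" "card {z \<in> L. p z \<noteq> p y} \<le> l - 2"
        using part[of x x y] part[of y x y] that \<open>x \<noteq> y\<close> by auto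
      then have "card L \<le> 2 * (l - 2)" using card_le_two_complements[OF L(1) that(5)] by blast
      then show ?thesis using m CL l lc by simp
    qed
    consider (crossing) "p v \<noteq> p u" | (inside) "\<forall>x\<in>L. p x = p u"
      | (other) "p v = p u" "\<not> (\<forall>x\<in>L. p x = p u)" by argo
    then show ?thesis
    proof cases
      case crossing
      show ?thesis by (rule two[OF uv(1,2)]) (use uv crossing in simp_all)
    next
      \<comment> \<open>Here \<open>card L \<le> c\<close>, and one color on \<open>L\<close> is
        enough because \<open>l \<ge> 3\<close>.\<close>
      case inside
      then have "L \<subseteq> {x \<in> V. p x = p u}" using L(2) by blast
      then have "card L \<le> card {x \<in> V. p x = p u}"
        using fV by (simp add: card_mono)
      then show ?thesis using m CL l c[of "p u"] by simp
    next
      case other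
      then obtain w where w: "w \<in> L" "p w \<noteq> p u" by blast
      show ?thesis
      proof (cases "C w = C u")
        case True
        show ?thesis
          by (rule two[of w u]) (use True w L uv in auto)
      next
        \<comment> \<open>There is no slack here: \<open>card L \<le> (l - 2) + c\<close> needs the
          second color \<open>C w\<close> on \<open>L\<close>.\<close>
        case False
        then have "card {C w, C u} = 2" by simp
        moreover have "card {C w, C u} \<le> card (C ` L)"
          using w L by (intro card_mono) auto
        moreover have "card {x \<in> L. p x \<noteq> p w} \<le> l - 2"
          by (rule part[of w u v]) (use uv w(1) w(2)[symmetric] in simp_all)
        moreover have "card {x \<in> L. p x = p w} \<le> card {x \<in> V. p x = p w}"
          using fV L by (intro card_mono) auto
        moreover have "L = {x \<in> L. p x \<noteq> p w} \<union> {x \<in> L. p x = p w}" by blast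
        then have "card L \<le> card {x \<in> L. p x \<noteq> p w} + card {x \<in> L. p x = p w}"
          using card_Un_le[of "{x \<in> L. p x \<noteq> p w}" "{x \<in> L. p x = p w}"] by simp
        ultimately show ?thesis using m l c[of "p w"] by linarith
      qed
    qed
  qed
qed

text \<open>A class with more than \<open>2 * (l - 2)\<close> vertices lies in a single part. The
  parts containing no such class must be covered by the small classes, each smaller than a part, so
  there are at least as many small classes as such parts.\<close>

lemma cf_coloring_isolating_lower_bound:
  fixes p :: "'a \<Rightarrow> nat"
  assumes fV: "finite V" and l: "2 \<le> l" and C: "cf_coloring V (isolating_sets l V p) m C"
    and part: "\<And>i. i < k \<Longrightarrow> 2 * l \<le> card {x \<in> V. p x = i}"
  shows "k \<le> m"
proof (rule ccontr)
  assume "\<not> k \<le> m"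
  define D where "D j = {x \<in> V. C x = j}" for j
  define S where "S = {j \<in> {1..m}. 2 * (l - 2) < card (D j)}"
  have "S \<subseteq> {1..m}" by (auto simp: S_def)
  then have fS: "finite S" "card S \<le> m"
    using card_mono[of "{1..m}" S] by (auto intro: finite_subset)
  \<comment> \<open>Otherwise the class \<open>D j\<close> would contain an edge through both
    \<open>w\<close> and \<open>y\<close>, and this edge would be monochromatic.\<close>
  have mono: "card {x \<in> D j. p x \<noteq> p w} \<le> l - 2" if wy: "w \<in> D j" "y \<in> D j" "p y \<noteq> p w" for j w y
  proof (rule ccontr)
    assume "\<not> ?thesis"
    then have "l - 1 \<le> card {x \<in> D j. p x \<noteq> p w}" by simp
    moreover have "D j \<subseteq> V" "{y} \<subseteq> {x \<in> D j. p x \<noteq> p w}" "0 < l" "card {y} \<le> l - 1"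
      using that l by (auto simp: D_def)
    ultimately obtain e where e: "e \<in> isolating_sets l V p" "e \<subseteq> D j" "w \<in> e" "{y} \<subseteq> e"
      using ex_isolating_set[of V "D j" w "{y}" p l] fV wy(1) by blast
    obtain x where x: "x \<in> e" "\<And>z. z \<in> e \<Longrightarrow> C z = C x \<Longrightarrow> z = x"
      using cf_coloring_edgeE[OF C e(1)] by blast
    have "C w = C x" "C y = C x" using x e by (auto simp: D_def)
    then have "w = y" using x e by auto
    then show False using wy by simp
  qed
  have eq: "p x = p y" if "j \<in> S" "x \<in> D j" "y \<in> D j" for j x y
  proof (rule ccontr)
    assume "p x \<noteq> p y"
    then have "card (D j) \<le> 2 * (l - 2)"
      using mono[of x j y] mono[of y j x] that fV card_le_two_complements[of "D j" "p x" "p y" p]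
      by (auto simp: D_def)
    then show False using that by (auto simp: S_def)
  qed
  have "\<forall>j. \<exists>i. j \<in> S \<longrightarrow> (\<forall>x\<in>D j. p x = i)" using eq by blast
  then obtain F where F: "\<And>j x. j \<in> S \<Longrightarrow> x \<in> D j \<Longrightarrow> p x = F j" by metis
  \<comment> \<open>The parts that contain no large class; all their vertices have colors outside
    \<open>S\<close>.\<close>
  define Q where "Q = {..<k} - F ` S"
  have "k - card S \<le> card Q"
    unfolding Q_def using diff_card_le_card_Diff[of "F ` S" "{..<k}"] fS card_image_le[of S F] by simp
  then have "(k - card S) * (2 * l) \<le> card Q * (2 * l)" by simp
  also have "\<dots> = (\<Sum>i\<in>Q. 2 * l)" by simp
  also have "\<dots> \<le> (\<Sum>i\<in>Q. card {x \<in> V. p x = i})"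
    using part by (intro sum_mono) (auto simp: Q_def)
  also have "\<dots> = card (\<Union>i\<in>Q. {x \<in> V. p x = i})"
    using fV by (subst card_UN_disjoint) (auto simp: Q_def)
  also have "\<dots> \<le> card (\<Union>j\<in>{1..m} - S. D j)"
  proof (rule card_mono)
    show "finite (\<Union>j\<in>{1..m} - S. D j)" using fV by (auto simp: D_def)
    show "(\<Union>i\<in>Q. {x \<in> V. p x = i}) \<subseteq> (\<Union>j\<in>{1..m} - S. D j)"
    proof
      fix x assume "x \<in> (\<Union>i\<in>Q. {x \<in> V. p x = i})"
      then have x: "x \<in> V" "p x \<in> Q" by auto
      have "x \<in> D (C x)" using x by (simp add: D_def)
      moreover have "C x \<in> {1..m}" using x C by (auto simp: cf_coloring_def)
      moreover have "C x \<notin> S" using F[of "C x" x] x by (auto simp: D_def Q_def)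
      ultimately show "x \<in> (\<Union>j\<in>{1..m} - S. D j)" by blast
    qed
  qed
  also have "\<dots> \<le> (\<Sum>j\<in>{1..m} - S. card (D j))" by (rule card_UN_le) simp
  \<comment> \<open>Rounding up to \<open>2 * l\<close> gives both ends of the chain a common factor
    to cancel.\<close>
  also have "\<dots> \<le> (\<Sum>j\<in>{1..m} - S. 2 * l)"
  proof (rule sum_mono)
    fix j assume "j \<in> {1..m} - S"
    then have "card (D j) \<le> 2 * (l - 2)" by (auto simp: S_def)
    then show "card (D j) \<le> 2 * l" by simp
  qed
  also have "\<dots> = (m - card S) * (2 * l)"
    using fS by (subst sum_constant, subst card_Diff_subset) (auto simp: S_def)
  \<comment> \<open>Since \<open>card S \<le> m < k\<close>, neither subtraction is truncated, so
    this contradicts \<open>m < k\<close>.\<close>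
  finally have "k - card S \<le> m - card S" using l by simp
  then show False using \<open>\<not> k \<le> m\<close> fS by simp
qed

section \<open>Residue classes as nearly equal parts\<close>

lemma card_residue_class_le:
  assumes "n \<le> k * c"
  shows "card {v \<in> {..<n}. v mod k = (i::nat)} \<le> c"
proof -
  have "inj_on (\<lambda>v. v div k) {v \<in> {..<n}. v mod k = i}"
    by (rule inj_onI) (metis (mono_tags, lifting) div_mult_mod_eq mem_Collect_eq)
  moreover have "(\<lambda>v. v div k) ` {v \<in> {..<n}. v mod k = i} \<subseteq> {..<c}"
    using assms by (auto simp: mult.commute intro!: less_mult_imp_div_less)
  ultimately show ?thesis using card_inj_on_le[of _ _ "{..<c}"] by fastforce
qed

lemma card_residue_class_ge:
  assumes "k * c \<le> n" "i < k"
  shows "c \<le> card {v \<in> {..<n}. v mod k = (i::nat)}"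
proof -
  have "inj_on (\<lambda>t. t * k + i) {..<c}"
    using assms by (auto simp: inj_on_def)
  moreover have "(\<lambda>t. t * k + i) ` {..<c} \<subseteq> {v \<in> {..<n}. v mod k = i}"
  proof (rule image_subsetI)
    fix t assume "t \<in> {..<c}"
    then have "Suc t * k \<le> c * k" by (intro mult_le_mono) auto
    then have "t * k + i < n" using assms by (simp add: mult.commute)
    then show "t * k + i \<in> {v \<in> {..<n}. v mod k = i}" using assms by simp
  qed
  ultimately show ?thesis using card_inj_on_le[of _ "{..<c}" "{v \<in> {..<n}. v mod k = i}"] by fastforce
qed

lemma chi_um_bound_attained:
  fixes l k n :: nat
  assumes l: "3 \<le> l" and k: "1 \<le> k" and k1: "k = 1 \<Longrightarrow> l = 3" and n: "2 * k * l \<le> n"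
  defines "E \<equiv> isolating_sets l {..<n} (\<lambda>v. v mod k)"
  shows "uniform_hypergraph l {..<n} E" "chi_cf {..<n} E = k"
    "int (chi_um {..<n} E) = int n - \<lceil>real n / real k\<rceil> - int l + 4"
proof -
  show H: "uniform_hypergraph l {..<n} E"
    unfolding E_def using l by (intro uniform_isolating_sets) auto
  then have hyp: "hypergraph {..<n} E" by (simp add: uniform_hypergraph_def)
  obtain c where c: "\<lceil>real n / real k\<rceil> = int c" "n \<le> k * c"
    using nat_ceiling_divideE[OF k] by metis
  \<comment> \<open>The part function itself is conflict-free; adding 1 moves the residues into
    \<open>{1..k}\<close>.\<close>
  have "\<exists>c. \<exists>!v. v \<in> e \<and> v mod k + 1 = c" if "e \<in> E" for e
  proof -
    obtain w where "w \<in> e" "\<And>v. v \<in> e \<Longrightarrow> v \<noteq> w \<Longrightarrow> v mod k \<noteq> w mod k"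
      using \<open>e \<in> E\<close> unfolding E_def isolating_sets_def by blast
    then have "\<exists>!v. v \<in> e \<and> v mod k + 1 = w mod k + 1" by auto
    then show ?thesis ..
  qed
  moreover have "v mod k + 1 \<in> {1..k}" for v
    using k mod_less_divisor[of k v] by (simp add: Suc_le_eq)
  ultimately have "cf_coloring {..<n} E k (\<lambda>v. v mod k + 1)"
    unfolding cf_coloring_def by blast
  then have "chi_cf {..<n} E \<le> k" unfolding chi_cf_def by (intro Least_le) blast
  moreover have "k \<le> chi_cf {..<n} E"
  proof -
    have part: "2 * l \<le> card {v \<in> {..<n}. v mod k = i}" if "i < k" for i
      using n that by (intro card_residue_class_ge) (auto simp: ac_simps)
    obtain f where "cf_coloring {..<n} E (chi_cf {..<n} E) f"
      using cf_coloring_chi_cf[OF hyp] by blast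
    then show ?thesis
      using cf_coloring_isolating_lower_bound[of "{..<n}" l "\<lambda>v. v mod k", OF _ _ _ part] l
      unfolding E_def by auto
  qed
  ultimately show chi: "chi_cf {..<n} E = k" by simp
  \<comment> \<open>The lower bound for unique-maximum colorings needs \<open>l \<le> c\<close>,
    which follows from \<open>2 * k * l \<le> n \<le> k * c\<close>.\<close>
  have "k * l \<le> k * c" using n c(2) by linarith
  then have lc: "l \<le> c" using k by simp
  obtain f where "um_coloring {..<n} E (chi_um {..<n} E) f"
    unfolding chi_um_def using LeastI_ex[OF ex_um_coloring[OF hyp]] by blast
  then have "n + 4 \<le> chi_um {..<n} E + c + l"
    using um_coloring_isolating_lower_bound[of "{..<n}" l "\<lambda>v. v mod k", OF _ l _ card_residue_class_le[OF c(2)] lc]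
    unfolding E_def by auto
  then have "int n - \<lceil>real n / real k\<rceil> - int l + 4 \<le> int (chi_um {..<n} E)"
    using c(1) by simp
  moreover have "int (chi_um {..<n} E) \<le> int n - \<lceil>real n / real k\<rceil> - int l + 4"
    using chi_um_upper_bound[OF H chi _ l k k1] n by simp
  ultimately show "int (chi_um {..<n} E) = int n - \<lceil>real n / real k\<rceil> - int l + 4" by simp
qed

theorem theorem2:
  fixes l k :: nat
  assumes "l \<ge> 3" and "k \<ge> 1" and "k = 1 \<Longrightarrow> l = 3"
  shows "(\<forall>(V :: 'a set) E n.
            uniform_hypergraph l V E \<and> chi_cf V E = k \<and> card V = n \<and> n \<ge> 2 * k * l \<longrightarrow>
            int (chi_um V E) \<le> int n - \<lceil>real n / real k\<rceil> - int l + 4)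
       \<and> (\<forall>n \<ge> 2 * k * l. \<exists>(V :: nat set) E.
            uniform_hypergraph l V E \<and> card V = n \<and> chi_cf V E = k \<and>
            int (chi_um V E) = int n - \<lceil>real n / real k\<rceil> - int l + 4)"
proof (intro conjI allI impI)
  fix V :: "'a set" and E n
  assume "uniform_hypergraph l V E \<and> chi_cf V E = k \<and> card V = n \<and> n \<ge> 2 * k * l"
  then show "int (chi_um V E) \<le> int n - \<lceil>real n / real k\<rceil> - int l + 4"
    using chi_um_upper_bound[of l V E k] assms by blast
next
  fix n assume "2 * k * l \<le> n"
  then show "\<exists>(V :: nat set) E.
      uniform_hypergraph l V E \<and> card V = n \<and> chi_cf V E = k \<and>
      int (chi_um V E) = int n - \<lceil>real n / real k\<rceil> - int l + 4"
    using chi_um_bound_attained[OF assms] card_lessThan by blast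
qed

end
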